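(* Let $G$ be a bridgeless graph with $n$ vertices in which every block is a complete graph. Then \[\overrightarrow{\mathrm{diam}}(G) \leq \begin{cases} \left\lfloor \frac{3n}{4} \right\rfloor & \text{if } n \text{ is even},\\ \left\lfloor \frac{3(n+1)}{4} \right\rfloor & \text{if } n \text{ is odd}.\end{cases}\]
   Context: All graphs are finite and simple. A graph is bridgeless if it is connected and has no bridge (an edge whose removal disconnects the graph). A block of $G$ is a maximal connected subgraph of $G$ that has no cut vertex; a graph all of whose blocks are complete graphs is called a block graph (or clique tree). An orientation of $G$ assigns a direction to each edge; it is strong if the resulting digraph is strongly connected. The diameter of a strong digraph is the maximum over ordered pairs $(u,v)$ of the directed distance from $u$ to $v$. The oriented diameter $\overrightarrow{\mathrm{diam}}(G)$ is the minimum diameter over all strong orientations of $G$. *)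

theory Defs
  imports "Graph_Theory.Graph_Theory"
begin

text \<open>
  Finite simple graphs are modelled, as in the \<open>Graph_Theory\<close> library, by finite loop-free
  symmetric digraphs without parallel arcs (locale \<^locale>\<open>graph\<close>): an edge \<open>{u, v}\<close> is the pair of
  arcs \<open>(u, v)\<close>, \<open>(v, u)\<close>. The names \<open>connected\<close> and \<open>graph\<close> are qualified because they
  also exist in \<open>Topological_Spaces\<close> and \<open>Map\<close>.
\<close>

definition del_edge :: "('a,'b) pre_digraph \<Rightarrow> 'a \<Rightarrow> 'a \<Rightarrow> ('a,'b) pre_digraph" where
  "del_edge G u v = G\<lparr>arcs := {e \<in> arcs G. arc_to_ends G e \<notin> {(u, v), (v, u)}}\<rparr>"

definition bridge :: "('a,'b) pre_digraph \<Rightarrow> 'a \<Rightarrow> 'a \<Rightarrow> bool" where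
  "bridge G u v \<longleftrightarrow> u \<rightarrow>\<^bsub>G\<^esub> v \<and> \<not> Digraph_Component.connected (del_edge G u v)"

definition bridgeless :: "('a,'b) pre_digraph \<Rightarrow> bool" where
  "bridgeless G \<longleftrightarrow> Digraph_Component.connected G \<and> (\<nexists>u v. bridge G u v)"

text \<open>
  In the library the null graph is not connected; the conjunct \<^prop>\<open>verts H \<noteq> {v}\<close> prevents
  the vertex of a one-vertex graph from counting as a cut vertex.
\<close>
definition cut_vertex :: "('a,'b) pre_digraph \<Rightarrow> 'a \<Rightarrow> bool" where
  "cut_vertex H v \<longleftrightarrow> v \<in> verts H \<and> verts H \<noteq> {v} \<and>
     \<not> Digraph_Component.connected (pre_digraph.del_vert H v)"

text \<open>
  Library subgraphs are sub-digraphs; \<^const>\<open>symmetric\<close> restricts to those which are graphs.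
\<close>
definition block :: "('a,'b) pre_digraph \<Rightarrow> ('a,'b) pre_digraph \<Rightarrow> bool" where
  "block G = pre_digraph.max_subgraph G
     (\<lambda>H. symmetric H \<and> Digraph_Component.connected H \<and> (\<nexists>v. cut_vertex H v))"

definition orientation :: "('a,'b) pre_digraph \<Rightarrow> ('a,'b) pre_digraph \<Rightarrow> bool" where
  "orientation G D \<longleftrightarrow> spanning D G \<and>
     (\<forall>u v. u \<rightarrow>\<^bsub>G\<^esub> v \<longrightarrow> (u \<rightarrow>\<^bsub>D\<^esub> v) \<noteq> (v \<rightarrow>\<^bsub>D\<^esub> u))"

definition strong_orientation :: "('a,'b) pre_digraph \<Rightarrow> ('a,'b) pre_digraph \<Rightarrow> bool" where
  "strong_orientation G D \<longleftrightarrow> orientation G D \<and> strongly_connected D"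

definition directed_distance :: "('a,'b) pre_digraph \<Rightarrow> 'a \<Rightarrow> 'a \<Rightarrow> ereal" where
  "directed_distance D u v = wf_digraph.\<mu> D (\<lambda>_. 1) u v"

definition digraph_diameter :: "('a,'b) pre_digraph \<Rightarrow> ereal" where
  "digraph_diameter D = (SUP (u, v) \<in> verts D \<times> verts D. directed_distance D u v)"

text \<open>
  The infimum is \<open>\<infinity>\<close> if there is no strong orientation, so a finite upper bound includes the
  existence of one; otherwise it is a minimum, as a finite graph has finitely many orientations.
\<close>
definition oriented_diameter :: "('a,'b) pre_digraph \<Rightarrow> ereal" where
  "oriented_diameter G = (INF D \<in> {D. strong_orientation G D}. digraph_diameter D)"

lemma finite_strong_orientations:
  assumes "Digraph.graph G"
  shows "finite {D. strong_orientation G D}"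
proof -
  interpret graph G by fact
  have "{D. strong_orientation G D} \<subseteq>
      (\<lambda>A. \<lparr>verts = verts G, arcs = A, tail = tail G, head = head G\<rparr>) ` Pow (arcs G)"
    by (auto simp: strong_orientation_def orientation_def spanning_def subgraph_def
        compatible_def image_iff intro!: pre_digraph.equality)
  then show ?thesis
    by (rule finite_subset) simp
qed

lemma oriented_diameter_attained:
  assumes "Digraph.graph G" and "oriented_diameter G < \<infinity>"
  shows "\<exists>D. strong_orientation G D \<and> digraph_diameter D = oriented_diameter G"
proof -
  let ?S = "digraph_diameter ` {D. strong_orientation G D}"
  have "?S \<noteq> {}"
  proof
    assume "?S = {}"
    then have "oriented_diameter G = \<infinity>"
      unfolding oriented_diameter_def by (simp only: Inf_empty top_ereal_def)
    with assms(2) show False by simp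
  qed
  moreover have "finite ?S"
    using finite_strong_orientations[OF assms(1)] by simp
  ultimately have "Inf ?S \<in> ?S"
    by (metis Min_Inf Min_in)
  then show ?thesis
    by (auto simp: oriented_diameter_def)
qed

end

theory Submission
  imports Defs
begin

text \<open>
  Every cycle of \<open>G\<close> spans a clique, and every edge lies in a triangle. For a vertex \<open>r\<close> and
  \<open>k = (n - 1) div 2\<close> one constructs, by induction on \<open>n\<close>, a strong orientation whose diameter is at
  most \<open>(3 k + 3) div 2\<close> and for which the out- and the in-eccentricity of \<open>r\<close> are at most
  \<open>(3 k + 1) / 2\<close>, one of them rounded up and the other one rounded down; reversing all arcs
  exchanges the two. If \<open>r\<close> is a cut vertex, orientations of two parts meeting in \<open>r\<close> are united.
  Otherwise \<open>r\<close> and its neighbours \<open>K\<close> form a clique, and removing the edges of that clique splits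
  \<open>G - r\<close> into branches, one for each \<open>p \<in> K\<close>. Take \<open>x \<in> K\<close> with a branch of maximal \<open>k\<close>
  and orient the clique as \<open>r \<rightarrow> x \<rightarrow> y \<rightarrow> r\<close> for all other \<open>y \<in> K\<close>. Choosing for each branch
  which of the two eccentricities is rounded up keeps all distances within the bounds.
\<close>

section \<open>Bounded reachability and paths\<close>

text \<open>Orientations are handled as plain relations, so that uniting and reversing them are set
  operations. Walks and costs in digraphs return only at the end.\<close>

definition reaches :: "'v rel \<Rightarrow> nat \<Rightarrow> 'v \<Rightarrow> 'v \<Rightarrow> bool" where
  "reaches D n u v \<longleftrightarrow> (\<exists>j\<le>n. (u, v) \<in> D ^^ j)"

lemma reaches_refl [simp]: "reaches D n u u"
  unfolding reaches_def by (intro exI[of _ 0]) simp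

lemma reaches_arc: "(u, v) \<in> D \<Longrightarrow> reaches D 1 u v"
  unfolding reaches_def by (intro exI[of _ 1]) simp

lemma reaches_trans: "reaches D i u v \<Longrightarrow> reaches D j v w \<Longrightarrow> reaches D (i + j) u w"
  unfolding reaches_def using relpow_trans[of u v _ D] add_mono[of _ i _ j] by blast

lemma reaches_mono:
  assumes "reaches D i u v" "D \<subseteq> D'" "i \<le> j"
  shows "reaches D' j u v"
proof -
  have sub: "D ^^ m \<subseteq> D' ^^ m" for m
    using assms(2) by (induction m) auto
  from assms obtain m where "m \<le> j" "(u, v) \<in> D ^^ m"
    unfolding reaches_def by (auto intro: order_trans)
  then show ?thesis
    unfolding reaches_def using sub[of m] by blast
qed

lemma reaches_le: "reaches D i u v \<Longrightarrow> i \<le> j \<Longrightarrow> reaches D j u v"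
  by (rule reaches_mono) auto

lemma reaches_converse: "reaches (D\<inverse>) n u v \<longleftrightarrow> reaches D n v u"
proof -
  have "(D\<inverse>) ^^ j = (D ^^ j)\<inverse>" for j
  proof (induction j)
    case (Suc j)
    have "(D\<inverse>) ^^ Suc j = (D O D ^^ j)\<inverse>"
      using Suc by (simp add: converse_relcomp)
    then show ?case by (simp add: relpow_commute)
  qed simp
  then show ?thesis by (simp add: reaches_def)
qed

text \<open>The path grows arc by arc and is cut back whenever the new endpoint already lies on it.
  The last property serves to keep a root that is not reachable off the path.\<close>

lemma rtrancl_distinct_path:
  assumes "(x, y) \<in> R\<^sup>*"
  obtains p where "p \<noteq> []" "hd p = x" "last p = y" "distinct p"
    "successively (\<lambda>u v. (u, v) \<in> R) p" "set p \<subseteq> R\<^sup>* `` {x}"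
proof -
  from assms have "\<exists>p. p \<noteq> [] \<and> hd p = x \<and> last p = y \<and> distinct p
    \<and> successively (\<lambda>u v. (u, v) \<in> R) p \<and> set p \<subseteq> R\<^sup>* `` {x}"
  proof (induction rule: rtrancl_induct)
    case base
    show ?case by (intro exI[of _ "[x]"]) simp
  next
    case (step y z)
    then obtain p where p: "p \<noteq> []" "hd p = x" "last p = y" "distinct p"
      "successively (\<lambda>u v. (u, v) \<in> R) p" "set p \<subseteq> R\<^sup>* `` {x}"
      by blast
    show ?case
    proof (cases "z \<in> set p")
      case True
      then obtain a b where ab: "p = a @ z # b"
        by (meson split_list)
      then show ?thesis
        using p by (intro exI[of _ "a @ [z]"])
          (cases a, auto simp: successively_append_iff successively_Cons hd_append)
    next
      case False
      then show ?thesis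
        using p step.hyps by (intro exI[of _ "p @ [z]"])
          (auto simp: successively_append_iff intro: rtrancl_into_rtrancl[OF step.hyps])
    qed
  qed
  then show thesis using that by blast
qed

section \<open>Orientations of block graphs\<close>

text \<open>The form in which the completeness of blocks is used: a cycle lies within one
  block.\<close>

locale clique_cycles =
  fixes E :: "'v rel"
  assumes sym_E: "sym E"
    and irrefl_E: "irrefl E"
    and cycle_clique: "\<lbrakk>distinct c; 3 \<le> length c; successively (\<lambda>u v. (u, v) \<in> E) c;
      (last c, hd c) \<in> E; u \<in> set c; v \<in> set c; u \<noteq> v\<rbrakk> \<Longrightarrow> (u, v) \<in> E"
begin

lemma E_sym: "(u, v) \<in> E \<Longrightarrow> (v, u) \<in> E"
  using sym_E by (rule symD)

lemma E_irrefl [simp]: "(u, u) \<notin> E"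
  using irrefl_E by (auto simp: irrefl_def)

section \<open>Properties passed down to branches, and bounds carried by their orientations\<close>

definition conn :: "'v set \<Rightarrow> bool" where
  "conn S \<longleftrightarrow> (\<forall>u\<in>S. \<forall>v\<in>S. (u, v) \<in> (Restr E S)\<^sup>*)"

text \<open>A local form of having no bridge: where cycles span cliques, an edge on a cycle lies in
  a triangle. Branches inherit this form directly.\<close>

definition triangulated :: "'v set \<Rightarrow> bool" where
  "triangulated S \<longleftrightarrow> (\<forall>u\<in>S. \<forall>v\<in>S. (u, v) \<in> E \<longrightarrow> (\<exists>w\<in>S. (u, w) \<in> E \<and> (v, w) \<in> E))"

definition orients :: "'v set \<Rightarrow> 'v rel \<Rightarrow> bool" where
  "orients S D \<longleftrightarrow> D \<subseteq> Restr E S \<and>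
     (\<forall>u\<in>S. \<forall>v\<in>S. (u, v) \<in> E \<longrightarrow> ((u, v) \<in> D) \<noteq> ((v, u) \<in> D))"

text \<open>\<open>f\<close> and \<open>g\<close> bound the out- and the in-eccentricity of the root
  \<open>r\<close>, and \<open>d\<close> bounds the diameter. The eccentricities are tracked because
  routes between different pieces pass through their roots.\<close>

definition routed :: "'v set \<Rightarrow> 'v \<Rightarrow> 'v rel \<Rightarrow> nat \<Rightarrow> nat \<Rightarrow> nat \<Rightarrow> bool" where
  "routed S r D f g d \<longleftrightarrow> orients S D \<and> (\<forall>v\<in>S. reaches D f r v \<and> reaches D g v r) \<and>
     (\<forall>u\<in>S. \<forall>v\<in>S. reaches D d u v)"

lemma routed_converse:
  assumes "routed S r D f g d"
  shows "routed S r (D\<inverse>) g f d"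
proof -
  have "D \<subseteq> Restr E S" "\<forall>u\<in>S. \<forall>v\<in>S. (u, v) \<in> E \<longrightarrow> ((u, v) \<in> D) \<noteq> ((v, u) \<in> D)"
    using assms by (simp_all add: routed_def orients_def)
  then have "orients S (D\<inverse>)"
    unfolding orients_def by (auto intro: E_sym)
  then show ?thesis
    using assms by (simp add: routed_def reaches_converse)
qed

lemma routed_mono:
  assumes "routed S r D f g d" "f \<le> f'" "g \<le> g'" "d \<le> d'"
  shows "routed S r D f' g' d'"
  using assms reaches_le[of D f _ _ f'] reaches_le[of D g _ _ g'] reaches_le[of D d _ _ d']
  unfolding routed_def by blast

text \<open>A walk can leave \<open>A\<close> only through \<open>r\<close>, so its part up to the
  first visit of \<open>r\<close> stays in \<open>A\<close>. An edge inside \<open>A\<close> has an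
  end other than \<open>r\<close>, and this end keeps the third vertex of the triangle in
  \<open>A\<close>.\<close>

lemma branch_conn_triangulated:
  assumes "conn S" "triangulated S" "A \<subseteq> S" "r \<in> A"
    and leave: "\<And>z w. \<lbrakk>z \<in> A; z \<noteq> r; w \<in> S; (z, w) \<in> E\<rbrakk> \<Longrightarrow> w \<in> A"
  shows "conn A" "triangulated A"
proof -
  have to_r: "(z, r) \<in> (Restr E A)\<^sup>*" if "z \<in> A" for z
  proof -
    have "(z, r) \<in> (Restr E S)\<^sup>*"
      using assms that unfolding conn_def by blast
    then show ?thesis using that
    proof (induction rule: converse_rtrancl_induct)
      case (step y w)
      show ?case
      proof (cases "y = r")
        case False
        then have "w \<in> A" using step leave by blast
        then show ?thesis
          using step by (intro converse_rtrancl_into_rtrancl[of y w]) auto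
      qed simp
    qed simp
  qed
  have "sym ((Restr E A)\<^sup>*)"
    using sym_E by (intro sym_rtrancl) (auto simp: sym_def)
  then have "(u, v) \<in> (Restr E A)\<^sup>*" if "u \<in> A" "v \<in> A" for u v
    using rtrancl_trans[OF to_r[OF that(1)] symD[OF _ to_r[OF that(2)]]] by blast
  then show "conn A"
    unfolding conn_def by blast
  show "triangulated A"
    unfolding triangulated_def
  proof (intro ballI impI)
    fix u v assume uv: "u \<in> A" "v \<in> A" "(u, v) \<in> E"
    then obtain w where w: "w \<in> S" "(u, w) \<in> E" "(v, w) \<in> E"
      using assms(2,3) unfolding triangulated_def by blast
    have "u \<noteq> r \<or> v \<noteq> r" using uv by auto
    then have "w \<in> A" using leave uv w by blast
    then show "\<exists>w\<in>A. (u, w) \<in> E \<and> (v, w) \<in> E" using w by blast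
  qed
qed

text \<open>Sharing only \<open>r\<close>, the two sides have no edge in common, and by
  \<open>sep\<close> there is none across. A route from one side to the other goes in to
  \<open>r\<close> and out again, hence the sums of a \<open>g\<close> and an
  \<open>f\<close>.\<close>

lemma routed_glue:
  assumes 1: "routed S\<^sub>1 r D\<^sub>1 f\<^sub>1 g\<^sub>1 d\<^sub>1" and 2: "routed S\<^sub>2 r D\<^sub>2 f\<^sub>2 g\<^sub>2 d\<^sub>2"
    and meet: "S\<^sub>1 \<inter> S\<^sub>2 = {r}"
    and sep: "\<And>u v. \<lbrakk>u \<in> S\<^sub>1; v \<in> S\<^sub>2; (u, v) \<in> E\<rbrakk> \<Longrightarrow> u = r \<or> v = r"
    and f: "f\<^sub>1 \<le> f" "f\<^sub>2 \<le> f" and g: "g\<^sub>1 \<le> g" "g\<^sub>2 \<le> g"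
    and d: "d\<^sub>1 \<le> d" "d\<^sub>2 \<le> d" "g\<^sub>1 + f\<^sub>2 \<le> d" "g\<^sub>2 + f\<^sub>1 \<le> d"
  shows "routed (S\<^sub>1 \<union> S\<^sub>2) r (D\<^sub>1 \<union> D\<^sub>2) f g d"
proof -
  let ?D = "D\<^sub>1 \<union> D\<^sub>2"
  have sub: "D\<^sub>1 \<subseteq> Restr E S\<^sub>1" "D\<^sub>2 \<subseteq> Restr E S\<^sub>2"
    using 1 2 unfolding routed_def orients_def by auto
  have or1: "((u, v) \<in> D\<^sub>1) \<noteq> ((v, u) \<in> D\<^sub>1)" if "u \<in> S\<^sub>1" "v \<in> S\<^sub>1" "(u, v) \<in> E" for u v
    using 1 that unfolding routed_def orients_def by auto
  have or2: "((u, v) \<in> D\<^sub>2) \<noteq> ((v, u) \<in> D\<^sub>2)" if "u \<in> S\<^sub>2" "v \<in> S\<^sub>2" "(u, v) \<in> E" for u v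
    using 2 that unfolding routed_def orients_def by auto
  have only1: "(u, v) \<notin> D\<^sub>2" if "u \<in> S\<^sub>1" "v \<in> S\<^sub>1" for u v
  proof
    assume "(u, v) \<in> D\<^sub>2"
    then have "u \<in> S\<^sub>2" "v \<in> S\<^sub>2" "(u, v) \<in> E" using sub by auto
    then have "u = r" "v = r" using that meet by auto
    with \<open>(u, v) \<in> E\<close> show False by simp
  qed
  have only2: "(u, v) \<notin> D\<^sub>1" if "u \<in> S\<^sub>2" "v \<in> S\<^sub>2" for u v
  proof
    assume "(u, v) \<in> D\<^sub>1"
    then have "u \<in> S\<^sub>1" "v \<in> S\<^sub>1" "(u, v) \<in> E" using sub by auto
    then have "u = r" "v = r" using that meet by auto
    with \<open>(u, v) \<in> E\<close> show False by simp
  qed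
  have r: "r \<in> S\<^sub>1" "r \<in> S\<^sub>2" using meet by auto
  have same: "(u \<in> S\<^sub>1 \<and> v \<in> S\<^sub>1) \<or> (u \<in> S\<^sub>2 \<and> v \<in> S\<^sub>2)"
    if "u \<in> S\<^sub>1 \<union> S\<^sub>2" "v \<in> S\<^sub>1 \<union> S\<^sub>2" "(u, v) \<in> E" for u v
    using that sep[of u v] sep[of v u] E_sym[of u v] r by blast
  have "orients (S\<^sub>1 \<union> S\<^sub>2) ?D"
    unfolding orients_def
  proof (intro conjI ballI impI)
    show "?D \<subseteq> Restr E (S\<^sub>1 \<union> S\<^sub>2)" using sub by blast
    fix u v assume uv: "u \<in> S\<^sub>1 \<union> S\<^sub>2" "v \<in> S\<^sub>1 \<union> S\<^sub>2" "(u, v) \<in> E"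
    from same[OF this] show "((u, v) \<in> ?D) \<noteq> ((v, u) \<in> ?D)"
      using or1[of u v] or2[of u v] only1[of u v] only1[of v u] only2[of u v] only2[of v u] uv
      by auto
  qed
  moreover have out1: "reaches ?D f\<^sub>1 r v" "reaches ?D g\<^sub>1 v r" if "v \<in> S\<^sub>1" for v
    using 1 that unfolding routed_def by (auto intro: reaches_mono[of D\<^sub>1])
  moreover have out2: "reaches ?D f\<^sub>2 r v" "reaches ?D g\<^sub>2 v r" if "v \<in> S\<^sub>2" for v
    using 2 that unfolding routed_def by (auto intro: reaches_mono[of D\<^sub>2])
  moreover have "reaches ?D d u v" if "u \<in> S\<^sub>1" "v \<in> S\<^sub>1" for u v
    using 1 that d unfolding routed_def by (auto intro: reaches_mono[of D\<^sub>1 d\<^sub>1])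
  moreover have "reaches ?D d u v" if "u \<in> S\<^sub>2" "v \<in> S\<^sub>2" for u v
    using 2 that d unfolding routed_def by (auto intro: reaches_mono[of D\<^sub>2 d\<^sub>2])
  moreover have "reaches ?D d u v" if "u \<in> S\<^sub>1" "v \<in> S\<^sub>2" for u v
    using reaches_le[OF reaches_trans[OF out1(2)[OF that(1)] out2(1)[OF that(2)]] d(3)] .
  moreover have "reaches ?D d u v" if "u \<in> S\<^sub>2" "v \<in> S\<^sub>1" for u v
    using reaches_le[OF reaches_trans[OF out2(2)[OF that(1)] out1(1)[OF that(2)]] d(4)] .
  ultimately show ?thesis
    unfolding routed_def
    using f g reaches_le[of ?D f\<^sub>1 _ _ f] reaches_le[of ?D f\<^sub>2 _ _ f]
      reaches_le[of ?D g\<^sub>1 _ _ g] reaches_le[of ?D g\<^sub>2 _ _ g] by blast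
qed

text \<open>The constants are the distances along \<open>r\<close>, \<open>x\<close>,
  \<open>y\<close>, \<open>r\<close>: from \<open>r\<close> 1 to \<open>x\<close> and 2 to any other
  \<open>y\<close>; to \<open>r\<close> 2 from \<open>x\<close> and 1 from \<open>y\<close>; 1 from
  \<open>x\<close> to \<open>y\<close>, 2 back, and 3 between two vertices other than
  \<open>x\<close>. The vertex \<open>y0\<close> gives \<open>x\<close> its way to
  \<open>r\<close>.\<close>

lemma routed_clique:
  fixes T :: "'v \<Rightarrow> 'v set"
  assumes "finite K" and x: "x \<in> K" and y0: "y0 \<in> K" "y0 \<noteq> x"
    and r: "\<And>p. p \<in> K \<Longrightarrow> r \<notin> T p"
    and disj: "\<And>p q. \<lbrakk>p \<in> K; q \<in> K; p \<noteq> q\<rbrakk> \<Longrightarrow> T p \<inter> T q = {}"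
    and rK: "\<And>p v. \<lbrakk>p \<in> K; v \<in> T p\<rbrakk> \<Longrightarrow> (r, v) \<in> E \<longleftrightarrow> v = p"
    and cross: "\<And>p q u v. \<lbrakk>p \<in> K; q \<in> K; p \<noteq> q; u \<in> T p; v \<in> T q\<rbrakk>
      \<Longrightarrow> (u, v) \<in> E \<longleftrightarrow> u = p \<and> v = q"
    and own: "\<And>p. p \<in> K \<Longrightarrow> p \<in> T p"
    and routed: "\<And>p. p \<in> K \<Longrightarrow> routed (T p) p (D p) (f p) (g p) (d p)"
    and F: "1 + f x \<le> F" "\<And>y. \<lbrakk>y \<in> K; y \<noteq> x\<rbrakk> \<Longrightarrow> 2 + f y \<le> F"
    and G: "2 + g x \<le> G" "\<And>y. \<lbrakk>y \<in> K; y \<noteq> x\<rbrakk> \<Longrightarrow> 1 + g y \<le> G"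
    and d: "\<And>p. p \<in> K \<Longrightarrow> d p \<le> d'" "F \<le> d'" "G \<le> d'"
      "\<And>y. \<lbrakk>y \<in> K; y \<noteq> x\<rbrakk> \<Longrightarrow> g x + 1 + f y \<le> d'"
      "\<And>y. \<lbrakk>y \<in> K; y \<noteq> x\<rbrakk> \<Longrightarrow> g y + 2 + f x \<le> d'"
      "\<And>y z. \<lbrakk>y \<in> K; y \<noteq> x; z \<in> K; z \<noteq> x; y \<noteq> z\<rbrakk> \<Longrightarrow> g y + 3 + f z \<le> d'"
  shows "\<exists>D'. routed (insert r (\<Union>p\<in>K. T p)) r D' F G d'"
proof -
  let ?S = "insert r (\<Union>p\<in>K. T p)"
  obtain h :: "'v \<Rightarrow> nat" where h: "inj_on h K"
    using finite_imp_inj_to_nat_seg[OF \<open>finite K\<close>] by blast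
  \<comment> \<open>Inside \<open>K - {x}\<close> the directions do not matter: two of its vertices are joined by a detour
    of length 3 through \<open>r\<close> and \<open>x\<close>.\<close>
  define C where "C = {(r, x)} \<union> {x} \<times> (K - {x}) \<union> (K - {x}) \<times> {r}
    \<union> {(y, z). y \<in> K - {x} \<and> z \<in> K - {x} \<and> h y < h z}"
  define D' where "D' = C \<union> (\<Union>p\<in>K. D p)"
  have sub: "D p \<subseteq> Restr E (T p)" if "p \<in> K" for p
    using routed[OF that] unfolding routed_def orients_def by blast
  have inner: "((u, v) \<in> D p) \<noteq> ((v, u) \<in> D p)" if "p \<in> K" "u \<in> T p" "v \<in> T p" "(u, v) \<in> E" for p u v
    using routed[OF that(1)] that unfolding routed_def orients_def by blast
  have uniq: "p = q" if "p \<in> K" "q \<in> K" "u \<in> T p" "u \<in> T q" for p q u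
    using disj[OF that(1,2)] that(3,4) by blast
  have K_T: "q = p" if "p \<in> K" "q \<in> K" "q \<in> T p" for p q
    using uniq[OF that(1,2,3) own[OF that(2)]] by simp
  have rnK: "r \<notin> K" using own r by blast
  have C_K: "u \<in> insert r K \<and> v \<in> insert r K \<and> u \<noteq> v" if "(u, v) \<in> C" for u v
    using that x rnK unfolding C_def by auto
  have clique: "(p, q) \<in> E" if "p \<in> K" "q \<in> K" "p \<noteq> q" for p q
    using cross[OF that own[OF that(1)] own[OF that(2)]] by simp
  have rE: "(r, p) \<in> E" "(p, r) \<in> E" if "p \<in> K" for p
    using rK[OF that own[OF that]] E_sym by auto
  have C_E: "(u, v) \<in> E" if "(u, v) \<in> C" for u v
    using C_K[OF that] clique rE by blast
  have C_tour: "((u, v) \<in> C) \<noteq> ((v, u) \<in> C)" if "u \<in> insert r K" "v \<in> insert r K" "u \<noteq> v" for u v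
  proof -
    have "h u \<noteq> h v" if "u \<in> K" "v \<in> K" using h that \<open>u \<noteq> v\<close> by (auto dest: inj_onD)
    then show ?thesis
      using that x rnK unfolding C_def by auto
  qed
  \<comment> \<open>A branch meets the clique only in its root, so the two share no edge:
    \<open>D'\<close> agrees with \<open>D p\<close> inside \<open>T p\<close> and with
    \<open>C\<close> on \<open>insert r K\<close>.\<close>
  have D'_in: "(u, v) \<in> D' \<longleftrightarrow> (u, v) \<in> D p" if "p \<in> K" "u \<in> T p" "v \<in> T p" for p u v
  proof -
    have "(u, v) \<notin> C"
    proof
      assume "(u, v) \<in> C"
      from C_K[OF this] have "u = p" "v = p" "u \<noteq> v"
        using K_T[OF that(1) _ that(2)] K_T[OF that(1) _ that(3)] r[OF that(1)] that(2,3) by auto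
      then show False by simp
    qed
    moreover have "q = p" if "(u, v) \<in> D q" "q \<in> K" for q
      using sub[OF that(2)] that(1) uniq[OF that(2) \<open>p \<in> K\<close> _ \<open>u \<in> T p\<close>] by blast
    ultimately show ?thesis unfolding D'_def using \<open>p \<in> K\<close> by blast
  qed
  have D'_C: "(u, v) \<in> D' \<longleftrightarrow> (u, v) \<in> C" if "u \<in> insert r K" "v \<in> insert r K" for u v
  proof -
    have "False" if uv: "(u, v) \<in> D p" and "p \<in> K" for p
    proof -
      have "u \<in> T p" "v \<in> T p" "(u, v) \<in> E" using sub[OF \<open>p \<in> K\<close>] uv by auto
      then have "u = p" "v = p"
        using K_T[OF \<open>p \<in> K\<close>] r[OF \<open>p \<in> K\<close>] \<open>u \<in> insert r K\<close> \<open>v \<in> insert r K\<close> by auto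
      with \<open>(u, v) \<in> E\<close> show False by simp
    qed
    then show ?thesis unfolding D'_def by blast
  qed
  have orients: "orients ?S D'"
    unfolding orients_def
  proof (intro conjI ballI impI)
    have "C \<subseteq> Restr E ?S"
    proof (rule subrelI)
      fix u v assume "(u, v) \<in> C"
      with C_K[OF this] C_E[OF this] own show "(u, v) \<in> Restr E ?S" by auto
    qed
    moreover have "D p \<subseteq> Restr E ?S" if "p \<in> K" for p
      using sub[OF that] that by blast
    ultimately show "D' \<subseteq> Restr E ?S" unfolding D'_def by blast
  next
    fix u v assume uv: "u \<in> ?S" "v \<in> ?S" "(u, v) \<in> E"
    then have "u \<noteq> v" by auto
    show "((u, v) \<in> D') \<noteq> ((v, u) \<in> D')"
    proof (cases "\<exists>p\<in>K. u \<in> T p \<and> v \<in> T p")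
      case True
      then show ?thesis using D'_in inner uv(3) by blast
    next
      case False
      \<comment> \<open>An edge inside no single branch belongs to the clique, by \<open>rK\<close>
        if it meets \<open>r\<close> and by \<open>cross\<close> otherwise.\<close>
      have "u \<in> insert r K \<and> v \<in> insert r K"
      proof (cases "u = r \<or> v = r")
        case True
        then show ?thesis using uv rK E_sym[OF uv(3)] by auto
      next
        case no_r: False
        then obtain p q where pq: "p \<in> K" "q \<in> K" "u \<in> T p" "v \<in> T q" using uv by blast
        then have "p \<noteq> q" using False by blast
        then show ?thesis using cross[OF pq(1,2) _ pq(3,4)] uv(3) pq(1,2) by blast
      qed
      then show ?thesis using D'_C C_tour \<open>u \<noteq> v\<close> by blast
    qed
  qed
  have arc: "reaches D' 1 u v" if "(u, v) \<in> C" for u v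
    using that unfolding D'_def by (intro reaches_arc) blast
  have rx: "reaches D' 1 r x" and xy: "\<And>y. y \<in> K - {x} \<Longrightarrow> reaches D' 1 x y"
    and yr: "\<And>y. y \<in> K - {x} \<Longrightarrow> reaches D' 1 y r"
    by (intro arc, force simp: C_def)+
  have ry: "reaches D' 2 r y" if "y \<in> K - {x}" for y
    using reaches_trans[OF rx xy[OF that]] by (simp add: numeral_eq_Suc)
  have xr: "reaches D' 2 x r"
    using reaches_trans[OF xy[of y0] yr[of y0]] y0 by (simp add: numeral_eq_Suc)
  have yx: "reaches D' 2 y x" if "y \<in> K - {x}" for y
    using reaches_trans[OF yr[OF that] rx] by (simp add: numeral_eq_Suc)
  have yz: "reaches D' 3 y z" if "y \<in> K - {x}" "z \<in> K - {x}" for y z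
    using reaches_trans[OF yr[OF that(1)] ry[OF that(2)]] by (simp add: numeral_eq_Suc)
  have D_sub: "D p \<subseteq> D'" if "p \<in> K" for p using that unfolding D'_def by blast
  have down: "reaches D' (f p) p v" and up: "reaches D' (g p) v p"
    if "p \<in> K" "v \<in> T p" for p v
    using routed[OF that(1)] that reaches_mono[OF _ D_sub[OF that(1)] order_refl]
    unfolding routed_def by blast+
  have same: "reaches D' d' u v" if "p \<in> K" "u \<in> T p" "v \<in> T p" for p u v
    using routed[OF that(1)] that reaches_mono[OF _ D_sub[OF that(1)] d(1)[OF that(1)]]
    unfolding routed_def by blast
  have from_r: "reaches D' F r v" if "v \<in> ?S" for v
  proof (cases "v = r")
    case False
    then obtain p where p: "p \<in> K" "v \<in> T p" using \<open>v \<in> ?S\<close> by blast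
    show ?thesis
    proof (cases "p = x")
      case True
      then show ?thesis
        using reaches_le[OF reaches_trans[OF rx down[OF x]] F(1)] p by blast
    next
      case False
      then show ?thesis
        using reaches_le[OF reaches_trans[OF ry down[OF p]] F(2)] p by blast
    qed
  qed simp
  have to_r: "reaches D' G v r" if "v \<in> ?S" for v
  proof (cases "v = r")
    case False
    then obtain p where p: "p \<in> K" "v \<in> T p" using \<open>v \<in> ?S\<close> by blast
    show ?thesis
    proof (cases "p = x")
      case True
      then show ?thesis
        using reaches_trans[OF up[OF x] xr] G(1) p reaches_le[of D' "g x + 2" v r G] by simp
    next
      case False
      then show ?thesis
        using reaches_trans[OF up[OF p] yr] G(2)[of p] p reaches_le[of D' "g p + 1" v r G] by simp
    qed
  qed simp
  have diam: "reaches D' d' u v" if uv: "u \<in> ?S" "v \<in> ?S" for u v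
  proof (cases "u = r \<or> v = r")
    case True
    then show ?thesis
      using reaches_le[OF from_r d(2)] reaches_le[OF to_r d(3)] uv by blast
  next
    case False
    then obtain p q where pq: "p \<in> K" "q \<in> K" "u \<in> T p" "v \<in> T q" using uv by blast
    \<comment> \<open>From \<open>u\<close> up to its root \<open>p\<close>, then \<open>c\<close>
      steps through the clique, then down from \<open>q\<close> to \<open>v\<close>.\<close>
    have via: "reaches D' d' u v" if "reaches D' c p q" "g p + c + f q \<le> d'" for c
      using reaches_le[OF reaches_trans[OF reaches_trans[OF up[OF pq(1,3)] that(1)] down[OF pq(2,4)]] that(2)] .
    show ?thesis
    proof (cases "p = q")
      case True
      then show ?thesis using same pq by blast
    next
      case False
      consider "p = x" "q \<noteq> x" | "p \<noteq> x" "q = x" | "p \<noteq> x" "q \<noteq> x" using False by blast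
      then show ?thesis
      proof cases
        case 1
        then show ?thesis using via[of 1] xy[of q] d(4)[of q] pq by simp
      next
        case 2
        then show ?thesis using via[of 2] yx[of p] d(5)[of p] pq by simp
      next
        case 3
        then show ?thesis using via[of 3] yz[of p q] d(6)[of p q] pq False by simp
      qed
    qed
  qed
  show ?thesis
    unfolding routed_def using orients from_r to_r diam by blast
qed

end

text \<open>A chain of \<open>k\<close> triangles, rooted at a free vertex of its first one, forces out- and
  in-eccentricity of the root to add up to \<open>3 k + 1\<close>; the two bounds split this sum evenly.\<close>

definition lower_ecc :: "nat \<Rightarrow> nat" where
  "lower_ecc k = (3 * k + 1) div 2"

text \<open>Rounding up would give 1 at \<open>k = 0\<close>, but a single vertex has eccentricity
  0. Trivial branches rely on this: in a triangle, \<open>2 + upper_ecc 0\<close> must not exceed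
  \<open>lower_ecc 1 = 2\<close>.\<close>

definition upper_ecc :: "nat \<Rightarrow> nat" where
  "upper_ecc k = (if k = 0 then 0 else (3 * k + 2) div 2)"

text \<open>For \<open>2 * k + 1\<close> and for \<open>2 * k + 2\<close> vertices alike, this is a
  quarter of \<open>3 * (2 * k + 2)\<close> rounded down, the bound of the theorem.\<close>

definition diam_bound :: "nat \<Rightarrow> nat" where
  "diam_bound k = (3 * k + 3) div 2"

lemmas bound_defs = lower_ecc_def upper_ecc_def diam_bound_def

lemma lower_ecc_mono: "i \<le> j \<Longrightarrow> lower_ecc i \<le> lower_ecc j"
  unfolding bound_defs by simp

lemma upper_ecc_mono: "i \<le> j \<Longrightarrow> upper_ecc i \<le> upper_ecc j"
  unfolding bound_defs by auto

lemma diam_bound_mono: "i \<le> j \<Longrightarrow> diam_bound i \<le> diam_bound j"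
  unfolding bound_defs by simp

section \<open>Existence of the orientation by induction on the number of vertices\<close>

context clique_cycles
begin

text \<open>A path from \<open>x\<close> to \<open>y\<close> in \<open>R\<close> avoids
  \<open>r\<close>, since no arc of \<open>R\<close> enters \<open>r\<close>; closed up through
  \<open>r\<close> it is a cycle and spans a clique. The second part shows that its first arc
  already joins two neighbours of \<open>r\<close>.\<close>

lemma fan_chord:
  assumes R: "R \<subseteq> E" "r \<notin> Range R"
    and xy: "(x, y) \<in> R\<^sup>*" "x \<noteq> y" and r: "(r, x) \<in> E" "(r, y) \<in> E"
  shows "(x, y) \<in> E" "\<exists>z. (x, z) \<in> R \<and> (r, z) \<in> E"
proof -
  obtain p where p: "p \<noteq> []" "hd p = x" "last p = y" "distinct p"
    "successively (\<lambda>u v. (u, v) \<in> R) p" "set p \<subseteq> R\<^sup>* `` {x}"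
    using rtrancl_distinct_path[OF xy(1)] .
  then obtain q where "p = x # q" by (cases p) auto
  moreover have "q \<noteq> []" using p xy(2) calculation by auto
  ultimately obtain z q' where pz: "p = x # z # q'" by (cases q) auto
  have "(x, r) \<notin> R\<^sup>*"
  proof
    assume "(x, r) \<in> R\<^sup>*"
    then show False
      by (cases rule: rtranclE) (use R(2) r(1) in auto)
  qed
  then have dist: "distinct (r # p)" using p by auto
  have "successively (\<lambda>u v. (u, v) \<in> E) p"
    using p(5) R(1) by (auto elim: successively_mono)
  then have succ: "successively (\<lambda>u v. (u, v) \<in> E) (r # p)"
    using p r(1) by (simp add: successively_Cons)
  have last: "(last (r # p), hd (r # p)) \<in> E"
    using p r(2) E_sym by auto
  have y: "y \<in> set p" using p by (metis last_in_set)
  have len: "3 \<le> length (r # p)" using pz by simp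
  note cc = cycle_clique[OF dist len succ last]
  show "(x, y) \<in> E" using cc[of x y] y xy(2) pz by auto
  have "(x, z) \<in> R" using p(5) pz by simp
  moreover have "(r, z) \<in> E" using cc[of r z] pz dist by auto
  ultimately show "\<exists>z. (x, z) \<in> R \<and> (r, z) \<in> E" by blast
qed

lemma routed_exists:
  assumes "finite S" "r \<in> S" "conn S" "triangulated S"
  shows "\<exists>D. routed S r D (upper_ecc ((card S - 1) div 2)) (lower_ecc ((card S - 1) div 2))
    (diam_bound ((card S - 1) div 2))"
  using assms
proof (induction "card S" arbitrary: S r rule: less_induct)
  case less
  \<comment> \<open>If all blocks are triangles, \<open>k\<close> is their number. Rounding down
    makes it superadditive when the graph is split at \<open>r\<close>.\<close>
  define k where "k = (card S - 1) div 2"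
  define N where "N = Restr E (S - {r})"
  consider (single) "S = {r}"
    | (cut) u v where "u \<in> S - {r}" "v \<in> S - {r}" "(u, v) \<notin> N\<^sup>*"
    | (noncut) "S \<noteq> {r}" "\<And>u v. \<lbrakk>u \<in> S - {r}; v \<in> S - {r}\<rbrakk> \<Longrightarrow> (u, v) \<in> N\<^sup>*"
    by blast
  then show ?case
  proof cases
    case single
    then have "routed S r {} 0 0 0"
      by (simp add: routed_def orients_def)
    then show ?thesis using routed_mono by blast
  next
    case cut
    \<comment> \<open>The component of \<open>u\<close> after deletion of \<open>r\<close>. The two
      parts to be glued are \<open>C\<close> with \<open>r\<close> added and everything outside
      \<open>C\<close>, which still contains \<open>r\<close>.\<close>
    define C where "C = N\<^sup>* `` {u}"
    have C_sub: "C \<subseteq> S - {r}"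
    proof
      fix z assume "z \<in> C"
      then have "(u, z) \<in> N\<^sup>*" by (simp add: C_def)
      then show "z \<in> S - {r}"
        by (cases rule: rtranclE) (use cut(1) in \<open>auto simp: N_def\<close>)
    qed
    have closed: "w \<in> C" if "z \<in> C" "w \<in> S - {r}" "(z, w) \<in> E" for z w
      using that C_sub rtrancl_into_rtrancl[of u z N w] by (auto simp: C_def N_def)
    let ?A = "insert r C" and ?B = "S - C"
    have r: "r \<in> ?A" "r \<in> ?B" using less.prems C_sub by auto
    have A: "?A \<subseteq> S" "?B \<subseteq> S" using less.prems C_sub by auto
    have u: "u \<in> C" by (simp add: C_def)
    have v: "v \<notin> C" using cut by (simp add: C_def)
    have cA: "conn ?A" "triangulated ?A"
      by (rule branch_conn_triangulated[OF less.prems(3,4) A(1) r(1)]; use closed in blast)+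
    have cB: "conn ?B" "triangulated ?B"
      by (rule branch_conn_triangulated[OF less.prems(3,4) A(2) r(2)]; use closed E_sym in blast)+
    have fin: "finite ?A" "finite ?B" using A less.prems(1) finite_subset by auto
    have less_card: "card ?A < card S" "card ?B < card S"
      using cut u v A less.prems(1) by (auto intro!: psubset_card_mono)
    define a where "a = (card ?A - 1) div 2"
    define b where "b = (card ?B - 1) div 2"
    obtain D1 where D1: "routed ?A r D1 (upper_ecc a) (lower_ecc a) (diam_bound a)"
      using less.hyps[OF less_card(1) fin(1) r(1) cA] unfolding a_def by blast
    obtain D2 where D2: "routed ?B r D2 (upper_ecc b) (lower_ecc b) (diam_bound b)"
      using less.hyps[OF less_card(2) fin(2) r(2) cB] unfolding b_def by blast
    have "card S = card C + card ?B"
      using less.prems(1) C_sub by (metis A(1) card_Diff_subset card_mono finite_subset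
        insert_subset le_add_diff_inverse)
    moreover have "card ?A = card C + 1"
      using C_sub fin by (subst card_insert_disjoint) auto
    moreover have "card ?B \<ge> 1" using r(2) fin(2) by (metis One_nat_def Suc_leI card_gt_0_iff empty_iff)
    ultimately have ab: "a + b \<le> k"
      unfolding a_def b_def k_def by linarith
    \<comment> \<open>One eccentricity rounded down and one rounded up add up to at most
      \<open>(3 * a + 1) / 2 + (3 * b + 2) / 2\<close>, which explains the summand 3 in
      \<open>diam_bound\<close>.\<close>
    have bounds: "lower_ecc a + upper_ecc b \<le> diam_bound k" "lower_ecc b + upper_ecc a \<le> diam_bound k"
      using ab unfolding bound_defs by (auto; linarith)+
    have "routed (?A \<union> ?B) r (D1 \<union> D2) (upper_ecc k) (lower_ecc k) (diam_bound k)"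
      by (rule routed_glue[OF D1 D2])
        (use ab r closed bounds in \<open>auto intro: upper_ecc_mono lower_ecc_mono diam_bound_mono\<close>)
    moreover have "?A \<union> ?B = S" using A by auto
    ultimately show ?thesis unfolding k_def by auto
  next
    case noncut
    define K where "K = {p \<in> S. (r, p) \<in> E}"
    define R where "R = {(u, v) \<in> N. \<not> (u \<in> K \<and> v \<in> K)}"
    define T where "T p = R\<^sup>* `` {p}" for p
    have symR: "sym (R\<^sup>*)"
      unfolding R_def N_def using sym_E by (intro sym_rtrancl) (auto simp: sym_def)
    have K: "K \<subseteq> S - {r}" "finite K" using less.prems(1) by (auto simp: K_def)
    have R_E: "R \<subseteq> E" "r \<notin> Range R" by (auto simp: R_def N_def)
    have N_E: "N \<subseteq> E" "r \<notin> Range N" by (auto simp: N_def)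
    \<comment> \<open>As \<open>r\<close> is not a cut vertex, two of its neighbours are joined by a
      path that avoids it.\<close>
    have clique: "(p, q) \<in> E" if "p \<in> K" "q \<in> K" "p \<noteq> q" for p q
      using fan_chord(1)[OF N_E noncut(2) that(3)] that K by (auto simp: K_def)
    \<comment> \<open>The first arc of such a path would join two vertices of \<open>K\<close>, and
      \<open>R\<close> contains no arc of this kind. Hence different vertices of \<open>K\<close>
      have disjoint branches.\<close>
    have K_T: "p = q" if "p \<in> K" "q \<in> K" "(p, q) \<in> R\<^sup>*" for p q
    proof (rule ccontr)
      assume "p \<noteq> q"
      from fan_chord(2)[OF R_E that(3) this] that(1,2) show False
        by (auto simp: K_def R_def N_def)
    qed
    have uniq: "p = q" if "p \<in> K" "q \<in> K" "u \<in> T p" "u \<in> T q" for p q u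
    proof -
      have "(p, u) \<in> R\<^sup>*" "(u, q) \<in> R\<^sup>*" using that symR by (auto simp: T_def dest: symD)
      then have "(p, q) \<in> R\<^sup>*" by (rule rtrancl_trans)
      then show ?thesis using K_T that by blast
    qed
    have own: "p \<in> T p" for p by (simp add: T_def)
    have T_sub: "T p \<subseteq> S - {r}" if "p \<in> K" for p
    proof
      fix z assume "z \<in> T p"
      then have "(p, z) \<in> R\<^sup>*" by (simp add: T_def)
      then show "z \<in> S - {r}"
        by (cases rule: rtranclE) (use that K in \<open>auto simp: R_def N_def\<close>)
    qed
    have step: "v \<in> T p" if "p \<in> K" "u \<in> T p" "v \<in> S - {r}" "(u, v) \<in> E" "\<not> (u \<in> K \<and> v \<in> K)" for p u v
    proof -
      have "(u, v) \<in> R" using that T_sub[OF that(1)] by (auto simp: R_def N_def)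
      then show ?thesis using that(2) rtrancl_into_rtrancl[of p u R v] by (simp add: T_def)
    qed
    have K_own: "u = p" if "p \<in> K" "u \<in> T p" "u \<in> K" for p u
      using K_T[of p u] that by (simp add: T_def)
    obtain s where s: "s \<in> S" "s \<noteq> r" using noncut(1) less.prems(2) by blast
    obtain p0 where p0: "p0 \<in> K"
    proof -
      have "(r, s) \<in> (Restr E S)\<^sup>*" using less.prems s unfolding conn_def by blast
      then show thesis
        by (cases rule: converse_rtranclE) (use s that in \<open>auto simp: K_def\<close>)
    qed
    note into_T = step
    \<comment> \<open>Along a walk from \<open>p0\<close> that avoids \<open>r\<close>, entering
      \<open>K\<close> opens the branch of the vertex entered; every other arc stays in the current
      branch.\<close>
    have cover: "\<exists>p\<in>K. z \<in> T p" if "z \<in> S - {r}" for z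
    proof -
      have "(p0, z) \<in> N\<^sup>*" using noncut(2) p0 K that by blast
      then show ?thesis
      proof (induction rule: rtrancl_induct)
        case base
        show ?case using p0 own by blast
      next
        case (step u v)
        then obtain p where p: "p \<in> K" "u \<in> T p" by blast
        show ?case
        proof (cases "v \<in> K")
          case True
          then show ?thesis using own by blast
        next
          case False
          then show ?thesis
            using into_T[OF p] step.hyps(2) p by (auto simp: N_def)
        qed
      qed
    qed
    have S_eq: "S = insert r (\<Union>p\<in>K. T p)"
      using cover T_sub less.prems(2) by blast
    have cT: "conn (T p)" "triangulated (T p)" if "p \<in> K" for p
    proof -
      have leave: "w \<in> T p" if "z \<in> T p" "z \<noteq> p" "w \<in> S" "(z, w) \<in> E" for z w
      proof -
        have "z \<notin> K" using K_own[OF \<open>p \<in> K\<close>] that by blast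
        moreover have "w \<noteq> r" using calculation that E_sym T_sub[OF \<open>p \<in> K\<close>] by (auto simp: K_def)
        ultimately show ?thesis using step[OF \<open>p \<in> K\<close> that(1)] that by blast
      qed
      have TS: "T p \<subseteq> S" using T_sub[OF that] by blast
      show "conn (T p)" "triangulated (T p)"
        by (rule branch_conn_triangulated[OF less.prems(3,4) TS own]; use leave in blast)+
    qed
    have fT: "finite (T p)" if "p \<in> K" for p
      using T_sub[OF that] less.prems(1) by (meson finite_Diff finite_subset)
    define \<kappa> where "\<kappa> p = (card (T p) - 1) div 2" for p
    have lessT: "card (T p) < card S" if "p \<in> K" for p
      using T_sub[OF that] less.prems(1,2) by (intro psubset_card_mono) auto
    have hi: "\<exists>D. routed (T p) p D (upper_ecc (\<kappa> p)) (lower_ecc (\<kappa> p)) (diam_bound (\<kappa> p))"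
      if "p \<in> K" for p
      using less.hyps[OF lessT fT own cT] that unfolding \<kappa>_def by blast
    have lo: "\<exists>D. routed (T p) p D (lower_ecc (\<kappa> p)) (upper_ecc (\<kappa> p)) (diam_bound (\<kappa> p))"
      if "p \<in> K" for p
      using hi[OF that] routed_converse by blast
    have cardT: "2 * \<kappa> p + 1 \<le> card (T p)" if "p \<in> K" for p
    proof -
      have "card (T p) \<noteq> 0" using own[of p] fT[OF that] by auto
      then show ?thesis unfolding \<kappa>_def by linarith
    qed
    have card_S: "card S = 1 + (\<Sum>p\<in>K. card (T p))"
    proof -
      have "card (\<Union>p\<in>K. T p) = (\<Sum>p\<in>K. card (T p))"
        using K(2) fT uniq by (intro card_UN_disjoint) blast+
      moreover have "r \<notin> (\<Union>p\<in>K. T p)" using T_sub by blast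
      ultimately show ?thesis
        using K(2) fT by (subst S_eq, subst card_insert_disjoint) auto
    qed
    \<comment> \<open>The branches and \<open>r\<close> have at most \<open>2 * k + 2\<close>
      vertices together. By parity, two branches leave a surplus of one unit in \<open>k2\<close>,
      and three leave the same in \<open>k3\<close>.\<close>
    have k_ge: "sum (\<lambda>p. 2 * \<kappa> p + 1) J \<le> 2 * k + 1" if "J \<subseteq> K" for J
    proof -
      have "sum (\<lambda>p. 2 * \<kappa> p + 1) J \<le> sum (\<lambda>p. 2 * \<kappa> p + 1) K"
        using that K(2) by (intro sum_mono2) auto
      also have "\<dots> \<le> (\<Sum>p\<in>K. card (T p))" using cardT by (intro sum_mono) auto
      finally show ?thesis using card_S unfolding k_def by linarith
    qed
    have k1: "\<kappa> p \<le> k" if "p \<in> K" for p using k_ge[of "{p}"] that by simp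
    have k2: "\<kappa> p + \<kappa> q + 1 \<le> k" if "p \<in> K" "q \<in> K" "p \<noteq> q" for p q
      using k_ge[of "{p, q}"] that by simp
    have k3: "\<kappa> p + \<kappa> q + \<kappa> t + 1 \<le> k" if "p \<in> K" "q \<in> K" "t \<in> K" "p \<noteq> q" "p \<noteq> t" "q \<noteq> t" for p q t
      using k_ge[of "{p, q, t}"] that by simp
    obtain x where x: "x \<in> K" "\<And>y. y \<in> K \<Longrightarrow> \<kappa> y \<le> \<kappa> x"
    proof -
      have "Max (\<kappa> ` K) \<in> \<kappa> ` K" using K(2) p0 by (intro Max_in) auto
      then obtain x where "x \<in> K" "\<kappa> x = Max (\<kappa> ` K)" by auto
      then show thesis using that K(2) by auto
    qed
    \<comment> \<open>The third vertex of a triangle on the edge between \<open>r\<close> and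
      \<open>x\<close>.\<close>
    obtain y0 where y0: "y0 \<in> K" "y0 \<noteq> x"
    proof -
      have "(r, x) \<in> E" "x \<in> S" using x by (auto simp: K_def)
      then obtain w where "w \<in> S" "(r, w) \<in> E" "(x, w) \<in> E"
        using less.prems(2,4) unfolding triangulated_def by blast
      moreover have "w \<noteq> x" using calculation(3) by auto
      ultimately show thesis using that[of w] by (auto simp: K_def)
    qed
    have cross: "(u, v) \<in> E \<longleftrightarrow> u = p \<and> v = q"
      if "p \<in> K" "q \<in> K" "p \<noteq> q" "u \<in> T p" "v \<in> T q" for p q u v
    proof
      assume uv: "(u, v) \<in> E"
      have "v \<notin> T p" using uniq that by blast
      then have "u \<in> K \<and> v \<in> K" using step[OF that(1,4) _ uv] T_sub[OF that(2)] that(5) by blast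
      then show "u = p \<and> v = q" using K_own that by blast
    qed (use clique that in blast)
    have rK: "(r, v) \<in> E \<longleftrightarrow> v = p" if "p \<in> K" "v \<in> T p" for p v
      using that T_sub[OF that(1)] K_own[OF that] by (auto simp: K_def)
    have disj: "T p \<inter> T q = {}" if "p \<in> K" "q \<in> K" "p \<noteq> q" for p q
      using uniq that by blast
    have rT: "r \<notin> T p" if "p \<in> K" for p using T_sub[OF that] by blast
    note clique_facts = K(2) x(1) y0 rT disj rK cross own
    show ?thesis
    proof (cases "\<forall>y\<in>K - {x}. \<kappa> y = 0")
      case True
      obtain D where D: "\<And>p. p \<in> K \<Longrightarrow>
          routed (T p) p (D p) (upper_ecc (\<kappa> p)) (lower_ecc (\<kappa> p)) (diam_bound (\<kappa> p))"
        using hi by metis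
      have kx: "\<kappa> x + 1 \<le> k" using k2[OF x(1) y0(1)] y0 by simp
      \<comment> \<open>Only \<open>T x\<close> is nontrivial: the longer way round the clique, from \<open>x\<close> to \<open>r\<close>, meets
        its smaller eccentricity, which leaves the sum at \<open>3 (\<kappa> x + 1) + 1\<close>.\<close>
      have "\<exists>D'. routed (insert r (\<Union>p\<in>K. T p)) r D' (lower_ecc k) (upper_ecc k) (diam_bound k)"
      proof (rule routed_clique[where K = K and x = x and ?y0.0 = y0 and T = T and D = D
            and f = "\<lambda>p. upper_ecc (\<kappa> p)" and g = "\<lambda>p. lower_ecc (\<kappa> p)"
            and d = "\<lambda>p. diam_bound (\<kappa> p)"])
        show "1 + upper_ecc (\<kappa> x) \<le> lower_ecc k" "2 + lower_ecc (\<kappa> x) \<le> upper_ecc k"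
          "lower_ecc k \<le> diam_bound k" "upper_ecc k \<le> diam_bound k"
          using kx unfolding bound_defs by (auto; linarith)+
        fix y assume y: "y \<in> K" "y \<noteq> x"
        then have "\<kappa> y = 0" using True by blast
        then show "2 + upper_ecc (\<kappa> y) \<le> lower_ecc k" "1 + lower_ecc (\<kappa> y) \<le> upper_ecc k"
          "lower_ecc (\<kappa> x) + 1 + upper_ecc (\<kappa> y) \<le> diam_bound k"
          "lower_ecc (\<kappa> y) + 2 + upper_ecc (\<kappa> x) \<le> diam_bound k"
          using kx unfolding bound_defs by (auto; linarith)+
        fix z assume z: "z \<in> K" "z \<noteq> x"
        then have "\<kappa> z = 0" using True by blast
        with \<open>\<kappa> y = 0\<close> show "lower_ecc (\<kappa> y) + 3 + upper_ecc (\<kappa> z) \<le> diam_bound k"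
          using kx unfolding bound_defs by (auto; linarith)
      qed (fact clique_facts D | rule own D | intro diam_bound_mono k1)+
      \<comment> \<open>Here the in-eccentricity came out rounded up; reversing all arcs restores
        the required order.\<close>
      then show ?thesis
        unfolding S_eq[symmetric] k_def using routed_converse by blast
    next
      case False
      then obtain y1 where y1: "y1 \<in> K" "y1 \<noteq> x" "\<kappa> y1 \<noteq> 0" by blast
      \<comment> \<open>Now the distance 2 from \<open>K - {x}\<close> to \<open>x\<close> has to meet the smaller eccentricities on
        both sides.\<close>
      define f where "f p = (if p = x then lower_ecc (\<kappa> p) else upper_ecc (\<kappa> p))" for p
      define g where "g p = (if p = x then upper_ecc (\<kappa> p) else lower_ecc (\<kappa> p))" for p
      have "\<exists>D. routed (T p) p D (f p) (g p) (diam_bound (\<kappa> p))" if "p \<in> K" for p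
        using hi[OF that] lo[OF that] unfolding f_def g_def by (cases "p = x") auto
      then obtain D where D: "\<And>p. p \<in> K \<Longrightarrow> routed (T p) p (D p) (f p) (g p) (diam_bound (\<kappa> p))"
        by metis
      \<comment> \<open>This is where the maximality of \<open>\<kappa> x\<close> enters.\<close>
      have x0: "\<kappa> x \<noteq> 0" using x(2)[OF y1(1)] y1(3) by simp
      \<comment> \<open>The nontrivial branch at \<open>y1\<close> yields one unit more than in the
        other case. It pays for \<open>2 + g x \<le> lower_ecc k\<close>, where \<open>g x\<close>
        is rounded up.\<close>
      have kx: "\<kappa> x + 2 \<le> k" using k2[OF x(1) y1(1)] y1 by simp
      have "\<exists>D'. routed (insert r (\<Union>p\<in>K. T p)) r D' (upper_ecc k) (lower_ecc k) (diam_bound k)"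
      proof (rule routed_clique[where K = K and x = x and ?y0.0 = y0 and T = T and D = D
            and f = f and g = g and d = "\<lambda>p. diam_bound (\<kappa> p)"])
        show "1 + f x \<le> upper_ecc k" "2 + g x \<le> lower_ecc k"
          "lower_ecc k \<le> diam_bound k" "upper_ecc k \<le> diam_bound k"
          using kx unfolding bound_defs f_def g_def by (auto; linarith)+
        fix y assume y: "y \<in> K" "y \<noteq> x"
        have ky: "\<kappa> x + \<kappa> y + 1 \<le> k" using k2[OF x(1) y(1)] y(2) by simp
        have fg: "f y = upper_ecc (\<kappa> y)" "g y = lower_ecc (\<kappa> y)" using y by (auto simp: f_def g_def)
        show "2 + f y \<le> upper_ecc k" "1 + g y \<le> lower_ecc k"
          "g x + 1 + f y \<le> diam_bound k" "g y + 2 + f x \<le> diam_bound k"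
          using ky x0 unfolding fg unfolding bound_defs f_def g_def by (auto; linarith)+
        fix z assume z: "z \<in> K" "z \<noteq> x" "y \<noteq> z"
        \<comment> \<open>A detour of length 3 uses up two units of \<open>k\<close>: one is the
          surplus in \<open>k3\<close>, the other comes from
          \<open>\<kappa> x \<noteq> 0\<close>.\<close>
        have "\<kappa> x + \<kappa> y + \<kappa> z + 1 \<le> k" using k3[OF x(1) y(1) z(1)] y z by simp
        then show "g y + 3 + f z \<le> diam_bound k"
          using x0 z(2) unfolding fg unfolding bound_defs f_def by (auto; linarith)
      qed (fact clique_facts D | rule own D | intro diam_bound_mono k1)+
      then show ?thesis
        unfolding S_eq[symmetric] k_def .
    qed
  qed
qed

end

section \<open>Blocks, bridges and directed distance\<close>

lemma symmetric_connected_iff: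
  assumes "wf_digraph H" "symmetric H"
  shows "Digraph_Component.connected H \<longleftrightarrow>
    verts H \<noteq> {} \<and> (\<forall>u\<in>verts H. \<forall>v\<in>verts H. (u, v) \<in> (arcs_ends H)\<^sup>*)"
proof -
  interpret wf_digraph H by fact
  have "(arcs_ends H)\<^sup>s = arcs_ends H"
    using assms(2) by (auto simp: symcl_def symmetric_def dest: symD)
  then show ?thesis
    using reachable_conv' unfolding connected_conv reachable_def by auto
qed

lemma arcs_ends_induce_subgraph: "arcs_ends (G \<restriction> A) = Restr (arcs_ends G) A"
  by (auto simp: arcs_ends_conv)

lemma arcs_ends_del_vert: "arcs_ends (pre_digraph.del_vert G v) = Restr (arcs_ends G) (- {v})"
  by (auto simp: arcs_ends_conv pre_digraph.del_vert_def)

lemma arcs_ends_del_edge: "arcs_ends (del_edge G u v) = arcs_ends G - {(u, v), (v, u)}"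
  by (auto simp: arcs_ends_def del_edge_def arc_to_ends_def)

lemma successively_rtrancl:
  assumes "successively (\<lambda>u v. (u, v) \<in> E) p" "sym E" "u \<in> set p" "v \<in> set p"
  shows "(u, v) \<in> (Restr E (set p))\<^sup>*"
proof -
  have hd: "(hd p, w) \<in> (Restr E (set p))\<^sup>*" if "w \<in> set p" for w
    using assms(1) that
  proof (induction p)
    case (Cons a q)
    show ?case
    proof (cases "w = a")
      case False
      then have w: "w \<in> set q" "q \<noteq> []" using Cons.prems by auto
      then have "(hd q, w) \<in> (Restr E (set q))\<^sup>*"
        using Cons by (simp add: successively_Cons)
      moreover have "(Restr E (set q))\<^sup>* \<subseteq> (Restr E (set (a # q)))\<^sup>*"
        by (intro rtrancl_mono) auto
      moreover have "(a, hd q) \<in> Restr E (set (a # q))"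
        using Cons.prems w by (auto simp: successively_Cons)
      ultimately show ?thesis
        using converse_rtrancl_into_rtrancl[of a "hd q" "Restr E (set (a # q))" w] by auto
    qed simp
  qed simp
  have "sym ((Restr E (set p))\<^sup>*)"
    using assms(2) by (intro sym_rtrancl) (auto simp: sym_def)
  then show ?thesis
    using rtrancl_trans[OF symD[OF _ hd[OF assms(3)]] hd[OF assms(4)]] by blast
qed

text \<open>Among the admissible subgraphs containing \<open>H\<close>, one with the most vertices
  and arcs together is maximal: equal totals force both sets to be equal.\<close>

lemma (in graph) block_extends:
  assumes "subgraph H G" "symmetric H" "Digraph_Component.connected H" "\<nexists>v. cut_vertex H v"
  obtains B where "block G B" "subgraph H B"
proof -
  define P where "P H \<longleftrightarrow> symmetric H \<and> Digraph_Component.connected H \<and> (\<nexists>v. cut_vertex H v)"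
    for H :: "('a, 'b) pre_digraph"
  define Q where "Q B \<longleftrightarrow> subgraph H B \<and> subgraph B G \<and> P B" for B
  let ?m = "\<lambda>B :: ('a, 'b) pre_digraph. card (verts B) + card (arcs B)"
  have "subgraph H H" using assms(1) by (auto simp: subgraph_def compatible_def)
  then have "Q H" using assms by (simp add: Q_def P_def)
  moreover have "\<forall>B. Q B \<longrightarrow> ?m B \<le> ?m G"
    unfolding Q_def subgraph_def by (auto intro!: add_mono card_mono)
  ultimately have "\<exists>B. Q B \<and> (\<forall>B'. Q B' \<longrightarrow> ?m B' \<le> ?m B)"
    using ex_has_greatest_nat[of Q H ?m "Suc (?m G)"] by (simp add: less_Suc_eq_le)
  then obtain B where B: "Q B" "\<And>B'. Q B' \<Longrightarrow> ?m B' \<le> ?m B"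
    by blast
  have "B' = B" if "subgraph B B'" "subgraph B' G" "P B'" for B'
  proof -
    have "subgraph H B'"
      using B(1) that(1) subgraph_trans unfolding Q_def by blast
    then have "?m B' \<le> ?m B" using B(2) that by (simp add: Q_def)
    moreover have fin: "finite (verts B')" "finite (arcs B')"
      using that(2) unfolding subgraph_def by (auto intro: finite_subset)
    moreover have "verts B \<subseteq> verts B'" "arcs B \<subseteq> arcs B'"
      using that(1) by (auto simp: subgraph_def)
    ultimately have "card (verts B) \<le> card (verts B')" "card (arcs B) \<le> card (arcs B')"
      "verts B \<subseteq> verts B'" "arcs B \<subseteq> arcs B'" "?m B' \<le> ?m B"
      by (auto intro: card_mono)
    then have "verts B = verts B'" "arcs B = arcs B'"
      by (intro card_subset_eq[OF fin(1)] card_subset_eq[OF fin(2)]; linarith)+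
    then show ?thesis
      using that(1) by (auto simp: subgraph_def compatible_def)
  qed
  then have "block G B"
    using B(1) unfolding block_def max_subgraph_def Q_def P_def by blast
  then show thesis using that B(1) by (simp add: Q_def)
qed

text \<open>The subgraph induced by a cycle has no cut vertex, so some block contains it, and this
  block is complete.\<close>

lemma (in graph) clique_cycles_if_blocks_complete:
  assumes "\<forall>B. block G B \<longrightarrow> (\<exists>k. complete_digraph k B)"
  shows "clique_cycles (arcs_ends G)"
proof
  show sym: "sym (arcs_ends G)" using sym_arcs by (simp add: symmetric_def)
  show "irrefl (arcs_ends G)" using adj_not_same by (auto simp: irrefl_def)
  fix c u v
  assume c: "distinct c" "3 \<le> length c" "successively (\<lambda>u v. u \<rightarrow> v) c" "last c \<rightarrow> hd c"
    and uv: "u \<in> set c" "v \<in> set c" "u \<noteq> v"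
  let ?H = "G \<restriction> set c"
  have "c \<noteq> []" using c(2) by auto
  have c_verts: "set c \<subseteq> verts G"
  proof
    fix w assume "w \<in> set c"
    then have "(w, last c) \<in> (Restr (arcs_ends G) (set c))\<^sup>*"
      using successively_rtrancl[OF c(3) sym] \<open>c \<noteq> []\<close> by simp
    then show "w \<in> verts G"
      by (cases rule: converse_rtranclE) (use c(4) adj_in_verts in auto)
  qed
  have sub: "subgraph ?H G"
    using c_verts by (rule subgraph_induce_subgraphI)
  then have wf_H: "wf_digraph ?H" by (simp add: subgraph_def)
  have sym_H: "symmetric ?H"
    using sym unfolding symmetric_def arcs_ends_induce_subgraph by (auto simp: sym_def)
  have conn: "Digraph_Component.connected ?H"
    unfolding symmetric_connected_iff[OF wf_H sym_H] arcs_ends_induce_subgraph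
    using successively_rtrancl[OF c(3) sym] \<open>c \<noteq> []\<close> by simp
  have "\<not> cut_vertex ?H w" for w
  proof
    assume "cut_vertex ?H w"
    then have w: "w \<in> set c" and ncon: "\<not> Digraph_Component.connected (pre_digraph.del_vert ?H w)"
      by (auto simp: cut_vertex_def)
    from w obtain a b where ab: "c = a @ w # b" by (meson split_list)
    \<comment> \<open>Started just after \<open>w\<close>, the cycle without \<open>w\<close> is a
      path through all its other vertices.\<close>
    let ?p = "b @ a"
    have p: "successively (\<lambda>u v. u \<rightarrow> v) ?p"
      using c(3,4) unfolding ab by (auto simp: successively_append_iff successively_Cons hd_append split: if_splits)
    have set_p: "set ?p = set c - {w}" using c(1) unfolding ab by auto
    have ne: "?p \<noteq> []" using c(2) unfolding ab by auto
    let ?D = "pre_digraph.del_vert ?H w"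
    have wf_D: "wf_digraph ?D" by (rule wf_digraph.wf_digraph_del_vert[OF wf_H])
    have ends: "arcs_ends ?D = Restr (arcs_ends G) (set ?p)"
      unfolding arcs_ends_del_vert arcs_ends_induce_subgraph set_p by auto
    have sym_D: "symmetric ?D"
      using sym unfolding symmetric_def ends by (auto simp: sym_def)
    have verts_D: "verts ?D = set ?p" unfolding set_p by (simp add: pre_digraph.del_vert_def)
    have "Digraph_Component.connected ?D"
      unfolding symmetric_connected_iff[OF wf_D sym_D] ends verts_D
      using successively_rtrancl[OF p sym] ne by auto
    with ncon show False by contradiction
  qed
  then obtain B where B: "block G B" "subgraph ?H B"
    using block_extends[OF sub sym_H conn] by blast
  then obtain k where "complete_digraph k B" using assms by blast
  then have "arcs_ends B = {(u, v). (u, v) \<in> verts B \<times> verts B \<and> u \<noteq> v}"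
    unfolding complete_digraph_def by blast
  moreover have "set c \<subseteq> verts B" using B(2) by (simp add: subgraph_def)
  ultimately have "(u, v) \<in> arcs_ends B" using uv by auto
  moreover have "arcs_ends B \<subseteq> arcs_ends G"
    using B(1) unfolding block_def by (intro arcs_ends_mono) (rule subgraphI_max_subgraph)
  ultimately show "u \<rightarrow> v" by blast
qed

section \<open>From relations back to digraphs and their distances\<close>

lemma (in wf_digraph) relpow_awalk:
  assumes "(u, v) \<in> arcs_ends G ^^ j" "u \<in> verts G"
  shows "\<exists>p. awalk u p v \<and> length p = j"
  using assms
proof (induction j arbitrary: u)
  case 0
  then show ?case by (auto simp: awalk_Nil_iff)
next
  case (Suc j)
  then obtain w where w: "u \<rightarrow> w" "(w, v) \<in> arcs_ends G ^^ j" by (meson relpow_Suc_E2)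
  then obtain e where e: "e \<in> arcs G" "tail G e = u" "head G e = w" by (auto simp: arcs_ends_conv)
  obtain p where "awalk w p v" "length p = j" using Suc.IH[OF w(2)] w(1) adj_in_verts by blast
  then show ?case using e by (intro exI[of _ "e # p"]) (auto simp: awalk_Cons_iff)
qed

lemma directed_distance_le:
  assumes "wf_digraph D" "reaches (arcs_ends D) n u v" "u \<in> verts D"
  shows "directed_distance D u v \<le> ereal (real n)"
proof -
  interpret wf_digraph D by fact
  obtain j where j: "j \<le> n" "(u, v) \<in> arcs_ends D ^^ j" using assms(2) by (auto simp: reaches_def)
  then obtain p where p: "awalk u p v" "length p = j" using relpow_awalk assms(3) by blast
  have "directed_distance D u v \<le> ereal (awalk_cost (\<lambda>_. 1) p)"
    unfolding directed_distance_def by (rule min_cost_le_walk_cost[OF p(1)])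
  also have "awalk_cost (\<lambda>_. 1) p = real j"
    using p(2) by (simp add: awalk_cost_def sum_list_triv)
  finally show ?thesis using j(1) by (meson ereal_less_eq(3) of_nat_mono order_trans)
qed

lemma (in graph) oriented_diameter_le:
  assumes D: "D \<subseteq> arcs_ends G" "\<And>u v. u \<rightarrow> v \<Longrightarrow> ((u, v) \<in> D) \<noteq> ((v, u) \<in> D)"
    and reach: "\<And>u v. \<lbrakk>u \<in> verts G; v \<in> verts G\<rbrakk> \<Longrightarrow> reaches D n u v"
    and "verts G \<noteq> {}"
  shows "oriented_diameter G \<le> ereal (real n)"
proof -
  let ?D = "G\<lparr>arcs := {e \<in> arcs G. arc_to_ends G e \<in> D}\<rparr>"
  have ends: "arcs_ends ?D = D"
    using D(1) by (fastforce simp: arcs_ends_def arc_to_ends_def)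
  have wf: "wf_digraph ?D" by unfold_locales auto
  have "spanning ?D G"
    using wf wf_digraph by (auto simp: spanning_def subgraph_def compatible_def)
  then have "orientation G ?D" unfolding orientation_def ends using D(2) by blast
  moreover have "strongly_connected ?D"
  proof
    fix u v assume uv: "u \<in> verts ?D" "v \<in> verts ?D"
    then have "(u, v) \<in> (arcs_ends ?D)\<^sup>*"
      using reach unfolding ends reaches_def by (auto intro: relpow_imp_rtrancl)
    then show "u \<rightarrow>\<^sup>*\<^bsub>?D\<^esub> v" using wf_digraph.reachable_conv'[OF wf uv(1)] by blast
  qed (use assms(4) in simp)
  ultimately have "strong_orientation G ?D" by (simp add: strong_orientation_def)
  then have "oriented_diameter G \<le> digraph_diameter ?D"
    unfolding oriented_diameter_def by (intro INF_lower) simp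
  also have "\<dots> \<le> ereal (real n)"
    unfolding digraph_diameter_def
    by (rule SUP_least) (use directed_distance_le[OF wf] reach ends in auto)
  finally show ?thesis .
qed

text \<open>Without the edge its ends are still joined by a path, and the edge closes this path to a
  cycle spanning a clique. The path has an inner vertex, which is adjacent to both ends.\<close>

lemma (in graph) bridgeless_imp_triangulated:
  assumes "bridgeless G" "clique_cycles (arcs_ends G)"
  shows "clique_cycles.triangulated (arcs_ends G) (verts G)"
proof -
  interpret clique_cycles "arcs_ends G" by fact
  show ?thesis
    unfolding triangulated_def
  proof (intro ballI impI)
    fix u v assume uv: "u \<in> verts G" "v \<in> verts G" "u \<rightarrow> v"
    let ?H = "del_edge G u v"
    have con: "Digraph_Component.connected ?H"
      using assms(1) uv(3) unfolding bridgeless_def bridge_def by blast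
    have wf: "wf_digraph ?H" by unfold_locales (auto simp: del_edge_def)
    have sym: "symmetric ?H"
      unfolding symmetric_def arcs_ends_del_edge using sym_E by (auto simp: sym_def)
    have "(u, v) \<in> (arcs_ends ?H)\<^sup>*"
      using con uv(1,2) unfolding symmetric_connected_iff[OF wf sym] by (simp add: del_edge_def)
    then obtain p where p: "p \<noteq> []" "hd p = u" "last p = v" "distinct p"
      "successively (\<lambda>u v. (u, v) \<in> arcs_ends ?H) p"
      using rtrancl_distinct_path by metis
    have "u \<noteq> v" using uv(3) by auto
    then obtain z q where pz: "p = u # z # q" using p(1-3) by (cases p; cases "tl p") auto
    have "z \<noteq> v" using p(5) unfolding pz arcs_ends_del_edge by auto
    then have "q \<noteq> []" using p(3) pz by auto
    then have "3 \<le> length p" unfolding pz by (cases q) auto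
    moreover have "successively (\<lambda>u v. u \<rightarrow> v) p"
      using p(5) unfolding arcs_ends_del_edge by (auto elim: successively_mono)
    moreover have "last p \<rightarrow> hd p" using p uv(3) E_sym by simp
    ultimately have cc: "a \<rightarrow> b" if "a \<in> set p" "b \<in> set p" "a \<noteq> b" for a b
      using cycle_clique[OF p(4)] that by blast
    have "v \<in> set p" using p(1,3) last_in_set by blast
    then have "u \<rightarrow> z" "v \<rightarrow> z" using cc[of u z] cc[of v z] p(4) \<open>z \<noteq> v\<close> pz by auto
    then show "\<exists>w\<in>verts G. u \<rightarrow> w \<and> v \<rightarrow> w" using adj_in_verts by blast
  qed
qed

theorem theorem2:
  fixes G :: "('a, 'b) pre_digraph" and n :: nat
  assumes "Digraph.graph G"
    and "card (verts G) = n"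
    and "bridgeless G"
    and "\<forall>B. block G B \<longrightarrow> (\<exists>k. complete_digraph k B)"
  shows "oriented_diameter G \<le>
    ereal (of_int (if even n then \<lfloor>3 * real n / 4\<rfloor> else \<lfloor>3 * (real n + 1) / 4\<rfloor>))"
proof -
  interpret graph G by fact
  interpret clique_cycles "arcs_ends G" using assms(4) by (rule clique_cycles_if_blocks_complete)
  have con: "verts G \<noteq> {}" "\<forall>u\<in>verts G. \<forall>v\<in>verts G. (u, v) \<in> (arcs_ends G)\<^sup>*"
    using assms(3) unfolding bridgeless_def symmetric_connected_iff[OF wf_digraph sym_arcs] by auto
  have restr: "Restr (arcs_ends G) (verts G) = arcs_ends G"
    using adj_in_verts by auto
  then have "conn (verts G)" unfolding conn_def using con(2) by simp
  moreover have "triangulated (verts G)"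
    using bridgeless_imp_triangulated[OF assms(3) clique_cycles_axioms] .
  moreover obtain r where "r \<in> verts G" using con(1) by blast
  ultimately obtain D f g where D: "routed (verts G) r D f g (diam_bound ((n - 1) div 2))"
    using routed_exists[OF finite_verts] assms(2) by blast
  then have "oriented_diameter G \<le> ereal (real (diam_bound ((n - 1) div 2)))"
    using con(1) adj_in_verts
    by (intro oriented_diameter_le[of D]) (auto simp: routed_def orients_def)
  also have "\<dots> \<le> ereal (of_int (if even n then \<lfloor>3 * real n / 4\<rfloor> else \<lfloor>3 * (real n + 1) / 4\<rfloor>))"
  proof -
    let ?b = "diam_bound ((n - 1) div 2)"
    \<comment> \<open>For \<open>n = 0\<close>, truncated subtraction would give
      \<open>diam_bound 0 = 1\<close>, above the claimed 0.\<close>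
    have "n \<noteq> 0" using con(1) assms(2) by auto
    then have "4 * ?b \<le> 3 * (if even n then n else n + 1)"
      unfolding diam_bound_def by (cases "even n") (simp_all, presburger+)
    then have "real (4 * ?b) \<le> real (3 * (if even n then n else n + 1))"
      by (rule of_nat_mono)
    then have "int ?b \<le> (if even n then \<lfloor>3 * real n / 4\<rfloor> else \<lfloor>3 * (real n + 1) / 4\<rfloor>)"
      by (auto simp: le_floor_iff)
    then show ?thesis by (metis ereal_less_eq(3) of_int_le_iff of_int_of_nat_eq)
  qed
  finally show ?thesis .
qed

end
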